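(* Let $X,Y$ be Banach spaces, $D\subset X$ a nonempty open convex set, and $F:D\to Y$ a twice continuously (Fréchet) differentiable operator. Let $x_0\in D$ be such that $F'(x_0)^{-1}$ exists, and let $\beta,\eta,L>0$ be such that $$\|F'(x_0)^{-1}[F''(y)-F''(x)]\|\le L\|y-x\|\quad\text{for all }x,y\in D,$$ $$\|F'(x_0)^{-1}F(x_0)\|\le\beta,\qquad\|F'(x_0)^{-1}F''(x_0)\|\le\eta.$$ Suppose $$\beta<\frac{2(\eta+2\sqrt{\eta^2+2L})}{3(\eta+\sqrt{\eta^2+2L})^2}.$$ Let $f(t)=\beta-t+\frac{\eta}{2}t^2+\frac{L}{6}t^3$, let $r_1=2/(\eta+\sqrt{\eta^2+2L})$ be the positive root of $f'$, let $t^*$ be the smallest positive root of $f$ in $[0,r_1]$, and let $t^{**}$ be the root of $f$ in $[r_1,+\infty)$. Assume $B(x_0,t^{**})\subset D$. Then the sequence $\{x_k\}$ generated by Halley's method $$x_{k+1}=x_k-[I-L_F(x_k)]^{-1}F'(x_k)^{-1}F(x_k),\quad k=0,1,2,\ldots,$$ with starting point $x_0$ is well defined, is contained in $B(x_0,t^* )$, and converges to a point $x^*\in\overline{B(x_0,t^* )}$ which is a solution of $F(x)=0$. The limit $x^*$ is the unique zero of $F$ in $B(x_0,t^{**})$. Moreover, with $\{t_k\}$ the Halley sequence for $f$ started at $t_0=0$ (defined in the context), for all $k=0,1,\ldots$, $$\|x^*-x_{k+1}\|\le(t^*-t_{k+1})\left(\frac{\|x^*-x_k\|}{t^*-t_k}\right)^3,$$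 and $\{x_k\}$ converges Q-cubically with $$\|x^*-x_{k+1}\|\le\frac{3(\eta+Lt^* )^2+2L(1-\eta t^*-L(t^* )^2/2)}{9(1-\eta t^*-L(t^* )^2/2)^2}\,\|x^*-x_k\|^3.$$
   Context: $B(x,r)$ is the open ball with center $x$ and radius $r$, and $\overline{B(x,r)}$ its closure. $I$ is the identity operator. $L_F(x)=\frac12F'(x)^{-1}F''(x)F'(x)^{-1}F(x)$, i.e. the bounded linear operator $v\mapsto\frac12F'(x)^{-1}F''(x)\big(F'(x)^{-1}F(x),v\big)$ on $X$. Halley sequence for $f$: $t_0=0$, $t_{k+1}=t_k-\frac{1}{1-L_f(t_k)}\cdot\frac{f(t_k)}{f'(t_k)}$, where $L_f(t)=\frac{f(t)f''(t)}{2f'(t)^2}$. A sequence $x_n\to x^*$ converges Q-cubically if there are constants $c\ge0$, $N\ge0$ with $\|x^*-x_{n+1}\|\le c\|x^*-x_n\|^3$ for all $n\ge N$. *)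

theory Defs
  imports "HOL-Analysis.Analysis"
begin

definition blinfun_invertible :: "('a::real_normed_vector \<Rightarrow>\<^sub>L 'b::real_normed_vector) \<Rightarrow> bool" where
  "blinfun_invertible A \<longleftrightarrow> (\<exists>B. B o\<^sub>L A = id_blinfun \<and> A o\<^sub>L B = id_blinfun)"

(* Unspecified unless A is invertible. *)
definition blinfun_inv :: "('a::real_normed_vector \<Rightarrow>\<^sub>L 'b::real_normed_vector) \<Rightarrow> 'b \<Rightarrow>\<^sub>L 'a" where
  "blinfun_inv A = (THE B. B o\<^sub>L A = id_blinfun \<and> A o\<^sub>L B = id_blinfun)"

lemma blinfun_inv:
  assumes "blinfun_invertible A"
  shows "blinfun_inv A o\<^sub>L A = id_blinfun" "A o\<^sub>L blinfun_inv A = id_blinfun"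
proof -
  obtain B where B: "B o\<^sub>L A = id_blinfun" "A o\<^sub>L B = id_blinfun"
    using assms by (auto simp: blinfun_invertible_def)
  have uniq: "C = B" if "C o\<^sub>L A = id_blinfun" for C
  proof (rule blinfun_eqI)
    fix y
    have "C y = C ((A o\<^sub>L B) y)"
      by (simp only: B(2) blinfun_apply_id_blinfun)
    also have "\<dots> = (C o\<^sub>L A) (B y)"
      by (simp only: blinfun_apply_blinfun_compose)
    also have "\<dots> = B y"
      by (simp only: that blinfun_apply_id_blinfun)
    finally show "C y = B y" .
  qed
  have "blinfun_inv A = B"
    unfolding blinfun_inv_def using B by (intro the_equality conjI) (blast intro: uniq)+
  then show "blinfun_inv A o\<^sub>L A = id_blinfun" "A o\<^sub>L blinfun_inv A = id_blinfun"
    using B by simp_all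
qed

(* Bounded bilinear maps are curried as 'a \<Rightarrow>\<^sub>L 'b \<Rightarrow>\<^sub>L 'c, and
   the norm of that type is the usual bilinear operator norm.  The composition below is
   (u, v) \<mapsto> G (A u v). *)
definition blinfun_compose2 ::
  "('c::real_normed_vector \<Rightarrow>\<^sub>L 'd::real_normed_vector) \<Rightarrow>
   ('a::real_normed_vector \<Rightarrow>\<^sub>L 'b::real_normed_vector \<Rightarrow>\<^sub>L 'c) \<Rightarrow> 'a \<Rightarrow>\<^sub>L 'b \<Rightarrow>\<^sub>L 'd" where
  "blinfun_compose2 G A = Blinfun (\<lambda>u. G o\<^sub>L A u)"

lemma blinfun_compose2_apply [simp]:
  "blinfun_apply (blinfun_compose2 G A) u = G o\<^sub>L blinfun_apply A u"
proof -
  have "bounded_linear (\<lambda>u. G o\<^sub>L blinfun_apply A u)"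
    by (rule bounded_linear_compose
        [OF bounded_bilinear.bounded_linear_right[OF bounded_bilinear_blinfun_compose]
            blinfun.bounded_linear_right])
  then show ?thesis
    by (simp add: blinfun_compose2_def bounded_linear_Blinfun_apply)
qed

text \<open>In the following, \<open>F'\<close> and \<open>F''\<close> stand for the first and second derivative of \<open>F\<close>.\<close>

definition halley_operator ::
  "('a::banach \<Rightarrow> 'b::banach) \<Rightarrow> ('a \<Rightarrow> 'a \<Rightarrow>\<^sub>L 'b) \<Rightarrow> ('a \<Rightarrow> 'a \<Rightarrow>\<^sub>L 'a \<Rightarrow>\<^sub>L 'b) \<Rightarrow> 'a \<Rightarrow> 'a \<Rightarrow>\<^sub>L 'a" where
  "halley_operator F F' F'' x =
     (1/2) *\<^sub>R (blinfun_inv (F' x) o\<^sub>L blinfun_apply (F'' x) (blinfun_inv (F' x) (F x)))"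

primrec halley_seq ::
  "('a::banach \<Rightarrow> 'b::banach) \<Rightarrow> ('a \<Rightarrow> 'a \<Rightarrow>\<^sub>L 'b) \<Rightarrow> ('a \<Rightarrow> 'a \<Rightarrow>\<^sub>L 'a \<Rightarrow>\<^sub>L 'b) \<Rightarrow> 'a \<Rightarrow> nat \<Rightarrow> 'a" where
  "halley_seq F F' F'' x0 0 = x0"
| "halley_seq F F' F'' x0 (Suc k) =
     (let x = halley_seq F F' F'' x0 k in
      x - blinfun_inv (id_blinfun - halley_operator F F' F'' x) (blinfun_inv (F' x) (F x)))"

definition halley_real_L :: "(real \<Rightarrow> real) \<Rightarrow> real \<Rightarrow> real" where
  "halley_real_L f t = f t * deriv (deriv f) t / (2 * (deriv f t)\<^sup>2)"

primrec halley_real_seq :: "(real \<Rightarrow> real) \<Rightarrow> nat \<Rightarrow> real" where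
  "halley_real_seq f 0 = 0"
| "halley_real_seq f (Suc k) =
     (let t = halley_real_seq f k in t - 1 / (1 - halley_real_L f t) * (f t / deriv f t))"

definition majorant :: "real \<Rightarrow> real \<Rightarrow> real \<Rightarrow> real \<Rightarrow> real" where
  "majorant \<beta> \<eta> L t = \<beta> - t + \<eta> / 2 * t\<^sup>2 + L / 6 * t ^ 3"

definition Q_cubic :: "(nat \<Rightarrow> 'a::real_normed_vector) \<Rightarrow> 'a \<Rightarrow> bool" where
  "Q_cubic x l \<longleftrightarrow> x \<longlonglongrightarrow> l \<and>
     (\<exists>c\<ge>0. \<exists>N. \<forall>n\<ge>N. norm (l - x (Suc n)) \<le> c * norm (l - x n) ^ 3)"

end

(* Replacing F by F'(x0)^-1 F leaves Halley's iteration unchanged and makes F'(x0) = I. With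
   p = -f' and q = f'', the hypotheses give |I - F'(z)| <= 1 - p(s) and |F''(z)| <= q(s) whenever
   |z - x0| <= s, so by Neumann's lemma every estimate at x_k is an instance of the corresponding
   exact identity for the cubic f at t_k; this yields |x_k - x0| <= t_k, |F(x_k)| <= f(t_k),
   |x_(k+1) - x_k| <= t_(k+1) - t_k and the cubic error estimate for any zero z with
   |z - x_k| <= t* - t_k. That estimate propagates this last condition, so every zero in the closed
   t*-ball is the limit of x_k; a zero at distance s from x0 also satisfies f(s) >= 0, which
   excludes t* < s < t**. *)
theory Submission
  imports Defs
begin

section \<open>The Halley step of a scalar cubic\<close>

text \<open>At a point \<open>s\<close>, take \<open>\<phi> = f s\<close>, \<open>p = - f' s\<close> and \<open>q = f'' s\<close> for a cubic \<open>f\<close> with constant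
  third derivative \<open>L\<close> and root \<open>s + \<tau>\<close>; then \<open>\<delta>\<close> is the Halley step of \<open>f\<close> from \<open>s\<close>.\<close>

lemma halley_scalar_step:
  fixes \<phi> p q L \<tau> :: real
  assumes pos: "0 < \<phi>" "0 < p" "0 < q" "0 < L" "0 < \<tau>"
    and \<phi>: "\<phi> = p * \<tau> - q * \<tau>\<^sup>2 / 2 - L * \<tau> ^ 3 / 6"
  defines "l \<equiv> \<phi> * q / (2 * p\<^sup>2)"
  defines "\<delta> \<equiv> \<phi> / p / (1 - l)"
  shows "0 < l" "4 * l \<le> 1" "0 < \<delta>" "\<delta> < \<tau>"
    and "\<phi> \<le> p * \<delta>"
    and "\<phi> - p * \<delta> + q * \<delta>\<^sup>2 / 2 = q / 2 * (l * \<delta>\<^sup>2)"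
    and "(1 - l) * p * (\<tau> - \<delta>)
      = q / (2 * p) * (q / 2 * \<tau>\<^sup>2 + L / 6 * \<tau> ^ 3) * \<tau> + L / 6 * \<tau> ^ 3"
proof -
  \<comment> \<open>\<open>\<alpha>\<close> is the Newton step, so the Halley step satisfies
    \<open>(1 - l) * \<delta> = \<alpha>\<close>.\<close>
  define \<alpha> where "\<alpha> = \<phi> / p"
  show l0: "0 < l" using pos by (simp add: l_def)
  \<comment> \<open>Completing the square gives \<open>l \<le> 1/4\<close>; this produces the constant in the final cubic rate.\<close>
  have "p\<^sup>2 - 2 * \<phi> * q = (p - q * \<tau>)\<^sup>2 + q * L * \<tau> ^ 3 / 3"
    unfolding \<phi> by (simp add: field_simps power2_eq_square power3_eq_cube)
  moreover have "0 \<le> (p - q * \<tau>)\<^sup>2 + q * L * \<tau> ^ 3 / 3" using pos by simp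
  ultimately have "2 * \<phi> * q \<le> p\<^sup>2" by linarith
  then show l1: "4 * l \<le> 1" using pos by (simp add: l_def field_simps)
  have p\<alpha>: "\<phi> = p * \<alpha>" and \<alpha>0: "0 < \<alpha>" using pos by (simp_all add: \<alpha>_def)
  have pl: "p * l = q * \<alpha> / 2" using pos by (simp add: l_def \<alpha>_def power2_eq_square mult.commute)
  have \<alpha>\<delta>: "\<alpha> = (1 - l) * \<delta>" using l1 l0 by (simp add: \<delta>_def \<alpha>_def)
  show \<delta>0: "0 < \<delta>" unfolding \<delta>_def using pos l1 by (intro divide_pos_pos) simp_all
  have "p * (\<tau> - \<alpha>) = q / 2 * \<tau>\<^sup>2 + L / 6 * \<tau> ^ 3"
    using p\<alpha> \<phi> by (simp add: right_diff_distrib)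
  then have \<tau>\<alpha>: "\<tau> - \<alpha> = (q / 2 * \<tau>\<^sup>2 + L / 6 * \<tau> ^ 3) / p"
    using pos by (simp add: field_simps)
  \<comment> \<open>The factor \<open>(1 - l) * p\<close> clears both denominators. What remains
    contains the Newton error \<open>\<tau> - \<alpha>\<close>, already of second order in
    \<open>\<tau>\<close>, times one more \<open>\<tau>\<close>.\<close>
  have "(1 - l) * p * (\<tau> - \<delta>) = p * \<tau> - (p * l) * \<tau> - p * ((1 - l) * \<delta>)"
    by (simp add: algebra_simps)
  also have "\<dots> = p * \<tau> - q * \<alpha> / 2 * \<tau> - p * \<alpha>"
    by (simp only: pl \<alpha>\<delta>[symmetric])
  also have "\<dots> = q / 2 * (\<tau> - \<alpha>) * \<tau> + L / 6 * \<tau> ^ 3"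
    unfolding p\<alpha>[symmetric] unfolding \<phi> by (simp add: field_simps power2_eq_square)
  finally show eq: "(1 - l) * p * (\<tau> - \<delta>)
      = q / (2 * p) * (q / 2 * \<tau>\<^sup>2 + L / 6 * \<tau> ^ 3) * \<tau> + L / 6 * \<tau> ^ 3"
    unfolding \<tau>\<alpha> by simp
  have "0 < q / (2 * p) * (q / 2 * \<tau>\<^sup>2 + L / 6 * \<tau> ^ 3) * \<tau> + L / 6 * \<tau> ^ 3"
    using pos by (simp add: add_pos_pos)
  then have "0 < (1 - l) * p * (\<tau> - \<delta>)" by (simp only: eq)
  then show "\<delta> < \<tau>"
    using zero_less_mult_pos[of "(1 - l) * p" "\<tau> - \<delta>"] l1 pos by simp
  have "\<alpha> \<le> \<delta>" unfolding \<alpha>\<delta> using \<delta>0 l0 by (simp add: mult_le_cancel_right1)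
  then show "\<phi> \<le> p * \<delta>" using p\<alpha> pos by simp
  have "\<phi> - p * \<delta> = - (p * l) * \<delta>" unfolding p\<alpha> \<alpha>\<delta> by (simp add: algebra_simps)
  also have "\<dots> = - q / 2 * ((1 - l) * \<delta>) * \<delta>" by (simp only: pl \<alpha>\<delta>[symmetric]) simp
  finally show "\<phi> - p * \<delta> + q * \<delta>\<^sup>2 / 2 = q / 2 * (l * \<delta>\<^sup>2)"
    by (simp add: field_simps power2_eq_square)
qed

section \<open>Operators near the identity and a single Halley step\<close>

lemma blinfun_invertible_near_id:
  fixes T :: "'a::banach \<Rightarrow>\<^sub>L 'a"
  assumes "norm (id_blinfun - T) < 1"
  shows "blinfun_invertible T"
proof -
  \<comment> \<open>A right and a left inverse arise as fixed points of contractions on the space of operators.\<close>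
  let ?E = "id_blinfun - T"
  have "\<exists>!S. id_blinfun + (?E o\<^sub>L S) = S"
    using assms norm_blinfun_compose[of ?E]
    by (intro banach_fix_type[where c = "norm ?E"])
       (auto simp: dist_norm simp flip: bounded_bilinear.diff_right[OF bounded_bilinear_blinfun_compose])
  then obtain S where S: "id_blinfun + (?E o\<^sub>L S) = S" by blast
  have "\<exists>!S. id_blinfun + (S o\<^sub>L ?E) = S"
    using assms norm_blinfun_compose[of _ ?E]
    by (intro banach_fix_type[where c = "norm ?E"])
       (auto simp: dist_norm mult.commute simp flip: bounded_bilinear.diff_left[OF bounded_bilinear_blinfun_compose])
  then obtain R where R: "id_blinfun + (R o\<^sub>L ?E) = R" by blast
  have TS: "T (S v) = v" for v
    using arg_cong[OF S, of "\<lambda>B. blinfun_apply B v"] by (simp add: blinfun.bilinear_simps)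
  have RT: "R (T v) = v" for v
    using arg_cong[OF R, of "\<lambda>B. blinfun_apply B v"] by (simp add: blinfun.bilinear_simps)
  \<comment> \<open>The one-sided inverses coincide: \<open>R w = R (T (S w)) = S w\<close>.\<close>
  have "R = S" by (rule blinfun_eqI) (metis TS RT)
  then show ?thesis
    unfolding blinfun_invertible_def
    by (intro exI[of _ S]) (use RT in \<open>auto intro!: blinfun_eqI simp: TS \<open>R = S\<close>\<close>)
qed

text \<open>Reverse triangle inequality. For \<open>p > 0\<close>, applying it to a preimage under
  \<open>T\<close> bounds the inverse of \<open>T\<close> by \<open>1 / p\<close>.\<close>

lemma norm_blinfun_near_id:
  fixes T :: "'a::real_normed_vector \<Rightarrow>\<^sub>L 'a"
  assumes "norm (id_blinfun - T) \<le> 1 - p"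
  shows "p * norm v \<le> norm (T v)"
proof -
  have "norm v \<le> norm (T v) + norm ((id_blinfun - T) v)"
    using norm_triangle_ineq[of "T v" "v - T v"] by (simp add: blinfun.bilinear_simps)
  also have "norm ((id_blinfun - T) v) \<le> (1 - p) * norm v"
    using norm_blinfun[of "id_blinfun - T" v] assms by (meson mult_right_mono norm_ge_zero order_trans)
  finally show ?thesis by (simp add: algebra_simps)
qed

lemma blinfun_inv_apply:
  assumes "blinfun_invertible T"
  shows "blinfun_inv T (T v) = v" "T (blinfun_inv T w) = w"
  using arg_cong[OF blinfun_inv(1)[OF assms], of "\<lambda>B. blinfun_apply B v"]
    arg_cong[OF blinfun_inv(2)[OF assms], of "\<lambda>B. blinfun_apply B w"] by simp_all

lemma blinfun_inv_eqI:
  assumes "S o\<^sub>L T = id_blinfun" "T o\<^sub>L S = id_blinfun"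
  shows "blinfun_invertible T" "blinfun_inv T = S"
proof -
  show T: "blinfun_invertible T" using assms by (auto simp: blinfun_invertible_def)
  show "blinfun_inv T = S"
  proof (rule blinfun_eqI)
    fix y
    have "S (T (blinfun_inv T y)) = blinfun_inv T y"
      using arg_cong[OF assms(1), of "\<lambda>B. blinfun_apply B (blinfun_inv T y)"] by simp
    then show "blinfun_inv T y = S y" by (simp add: blinfun_inv_apply[OF T])
  qed
qed

text \<open>The operator counterpart of \<open>halley_scalar_step\<close>, with equalities weakened
  to norm bounds. The correction \<open>d\<close> solves \<open>d - M d = a\<close> for the Newton
  correction \<open>a\<close>; applying \<open>G' x\<close> to this equation removes all inverses.
  The displacement \<open>e\<close> is arbitrary, so that later it may lead from an iterate to any
  zero of \<open>G\<close>.\<close>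

lemma halley_operator_step:
  fixes G :: "'a::banach \<Rightarrow> 'a" and G' :: "'a \<Rightarrow> 'a \<Rightarrow>\<^sub>L 'a" and G'' :: "'a \<Rightarrow> 'a \<Rightarrow>\<^sub>L 'a \<Rightarrow>\<^sub>L 'a"
  assumes T: "norm (id_blinfun - G' x) \<le> 1 - p" and p: "0 < p"
    and g: "norm (G x) \<le> \<phi>" and Q: "norm (G'' x) \<le> q" and l: "l = \<phi> * q / (2 * p\<^sup>2)" "l < 1"
  defines "M \<equiv> halley_operator G G' G'' x"
  defines "d \<equiv> - blinfun_inv (id_blinfun - M) (blinfun_inv (G' x) (G x))"
  shows "blinfun_invertible (G' x)"
    and "blinfun_invertible (id_blinfun - M)"
    and "norm d \<le> \<phi> / p / (1 - l)"
    and "norm (G x + G' x d + (1/2) *\<^sub>R G'' x d d) \<le> q / 2 * (l * (norm d)\<^sup>2)"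
    and "\<And>e c. norm (- G x - G' x e - (1/2) *\<^sub>R G'' x e e) \<le> c * (norm e)^3 \<Longrightarrow> 
      (1 - l) * p * norm (e - d)
      \<le> q / (2 * p) * (q / 2 * (norm e)\<^sup>2 + c * norm e ^ 3) * norm e + c * norm e ^ 3"
proof -
  let ?N = "blinfun_inv (G' x)"
  show inv: "blinfun_invertible (G' x)"
    by (rule blinfun_invertible_near_id) (use T p in linarith)
  have N: "norm (?N v) \<le> norm v / p" for v
    using norm_blinfun_near_id[OF T, of "?N v"] p by (simp add: blinfun_inv_apply[OF inv] field_simps)
  have \<phi>0: "0 \<le> \<phi>" using g norm_ge_zero order_trans by blast
  have q0: "0 \<le> q" using Q norm_ge_zero order_trans by blast
  have l0: "0 \<le> l" using \<phi>0 q0 l by simp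
  define a where "a = - ?N (G x)"
  have a: "norm a \<le> \<phi> / p"
    using N[of "G x"] g p by (simp add: a_def) (meson divide_right_mono less_imp_le order_trans)
  have QQ: "norm (G'' x u v) \<le> q * norm u * norm v" for u v
  proof -
    have "norm (G'' x u v) \<le> norm (G'' x) * norm u * norm v"
      by (meson mult_right_mono norm_blinfun norm_ge_zero order_trans)
    also have "\<dots> \<le> q * norm u * norm v"
      by (intro mult_right_mono Q) simp_all
    finally show ?thesis .
  qed
  have Mv: "M v = - ((1/2) *\<^sub>R ?N (G'' x a v))" for v
    by (simp add: M_def halley_operator_def a_def blinfun.bilinear_simps)
  have Ml: "norm (M v) \<le> l * norm v" for v
  proof -
    have "norm (G'' x a v) \<le> q * (\<phi> / p) * norm v"
      using QQ[of a v] a q0 by (meson mult_left_mono mult_right_mono norm_ge_zero order_trans)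
    then have "norm (?N (G'' x a v)) \<le> q * (\<phi> / p) * norm v / p"
      using N[of "G'' x a v"] p by (meson divide_right_mono less_imp_le order_trans)
    then show ?thesis using p by (simp add: Mv l power2_eq_square field_simps)
  qed
  \<comment> \<open>Shaped like the hypothesis of \<open>norm_blinfun_near_id\<close>, with
    \<open>1 - l\<close> in the role of \<open>p\<close>.\<close>
  then have Mn: "norm (id_blinfun - (id_blinfun - M)) \<le> 1 - (1 - l)"
    using l0 by (simp add: norm_blinfun_bound)
  show inv2: "blinfun_invertible (id_blinfun - M)"
    by (rule blinfun_invertible_near_id) (use Mn l in linarith)
  have lower: "(1 - l) * norm v \<le> norm (v - M v)" for v
    using norm_blinfun_near_id[OF Mn, of v] by (simp add: blinfun.bilinear_simps)
  have "(id_blinfun - M) d = a"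
    unfolding d_def by (simp only: blinfun.minus_right blinfun_inv_apply[OF inv2] a_def)
  then have d: "d - M d = a" by (simp add: blinfun.bilinear_simps)
  show "norm d \<le> \<phi> / p / (1 - l)"
    using order_trans[OF lower[of d, unfolded d] a] l(2) by (simp add: pos_le_divide_eq mult.commute del: divide_divide_eq_left)
  have Ta: "G' x a = - G x" by (simp add: a_def blinfun.bilinear_simps blinfun_inv_apply[OF inv])
  have TM: "G' x (M v) = - ((1/2) *\<^sub>R G'' x a v)" for v
    by (simp add: Mv blinfun.bilinear_simps blinfun_inv_apply[OF inv])
  \<comment> \<open>Halley's equation becomes
    \<open>G x + G' x d + (1/2) *\<^sub>R G'' x a d = 0\<close>. The quadratic model has
    \<open>d\<close> in place of \<open>a\<close>, and \<open>d - a = M d\<close> is all that is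
    left of it.\<close>
  have "G' x d - G' x (M d) = - G x"
    using arg_cong[OF d, of "blinfun_apply (G' x)"] Ta by (simp add: blinfun.bilinear_simps)
  then have "G x + G' x d + (1/2) *\<^sub>R G'' x d d = (1/2) *\<^sub>R (G'' x d d - G'' x a d)"
    by (simp add: TM algebra_simps)
  also have "\<dots> = (1/2) *\<^sub>R G'' x (M d) d"
  proof -
    have "M d = d - a" using d by (simp add: algebra_simps)
    then show ?thesis by (simp add: blinfun.bilinear_simps)
  qed
  finally have "norm (G x + G' x d + (1/2) *\<^sub>R G'' x d d) = norm (G'' x (M d) d) / 2" by simp
  also have "\<dots> \<le> q * (l * norm d) * norm d / 2"
    using QQ[of "M d" d] Ml[of d] q0
    by (smt (verit) divide_right_mono mult_left_mono mult_right_mono norm_ge_zero)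
  finally show "norm (G x + G' x d + (1/2) *\<^sub>R G'' x d d) \<le> q / 2 * (l * (norm d)\<^sup>2)"
    by (simp add: power2_eq_square mult.assoc)
  fix e c
  define R where "R = - G x - G' x e - (1/2) *\<^sub>R G'' x e e"
  assume "norm (- G x - G' x e - (1/2) *\<^sub>R G'' x e e) \<le> c * (norm e)^3"
  then have R: "norm R \<le> c * norm e ^ 3" by (simp add: R_def)
  have Te: "G' x (e - a) = - ((1/2) *\<^sub>R G'' x e e + R)"
    by (simp add: R_def blinfun.bilinear_simps Ta)
  have "p * norm (e - a) \<le> norm ((1/2) *\<^sub>R G'' x e e + R)"
    using norm_blinfun_near_id[OF T, of "e - a"] unfolding Te norm_minus_cancel .
  also have "\<dots> \<le> q / 2 * (norm e)\<^sup>2 + c * norm e ^ 3"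
    using norm_triangle_ineq[of "(1/2) *\<^sub>R G'' x e e" R] QQ[of e e] R by (simp add: power2_eq_square)
  finally have ea: "norm (e - a) \<le> (q / 2 * (norm e)\<^sup>2 + c * norm e ^ 3) / p"
    using p by (simp add: field_simps)
  \<comment> \<open>\<open>e - d\<close> solves the same linear equation with right-hand side
    \<open>e - a - M e\<close>. Under \<open>G' x\<close> the two parts combine so that
    \<open>G'' x\<close> acts on \<open>e - a\<close>, which \<open>ea\<close> bounds to second
    order.\<close>
  have "(e - d) - M (e - d) = (e - a) - M e"
    using d by (simp add: blinfun.bilinear_simps algebra_simps)
  then have "G' x ((e - d) - M (e - d)) = G' x (e - a) - G' x (M e)"
    by (simp only: blinfun.diff_right)
  also have "\<dots> = - ((1/2) *\<^sub>R G'' x (e - a) e + R)"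
    unfolding Te TM by (simp add: blinfun.bilinear_simps algebra_simps)
  finally have "p * norm ((e - d) - M (e - d)) \<le> norm ((1/2) *\<^sub>R G'' x (e - a) e + R)"
    using norm_blinfun_near_id[OF T, of "(e - d) - M (e - d)"] by (metis norm_minus_cancel)
  also have "\<dots> \<le> q / 2 * norm (e - a) * norm e + c * norm e ^ 3"
    using norm_triangle_ineq[of "(1/2) *\<^sub>R G'' x (e - a) e" R] QQ[of "e - a" e] R by simp
  also have "\<dots> \<le> q / 2 * ((q / 2 * (norm e)\<^sup>2 + c * norm e ^ 3) / p) * norm e + c * norm e ^ 3"
    using q0 by (intro add_right_mono mult_right_mono mult_left_mono ea) simp_all
  also have "q / 2 * ((q / 2 * (norm e)\<^sup>2 + c * norm e ^ 3) / p) * norm e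
    = q / (2 * p) * (q / 2 * (norm e)\<^sup>2 + c * norm e ^ 3) * norm e" by simp
  finally have "p * norm ((e - d) - M (e - d))
    \<le> q / (2 * p) * (q / 2 * (norm e)\<^sup>2 + c * norm e ^ 3) * norm e + c * norm e ^ 3" .
  moreover have "p * ((1 - l) * norm (e - d)) \<le> p * norm ((e - d) - M (e - d))"
    using p lower[of "e - d"] by simp
  ultimately show "(1 - l) * p * norm (e - d)
      \<le> q / (2 * p) * (q / 2 * (norm e)\<^sup>2 + c * norm e ^ 3) * norm e + c * norm e ^ 3"
    by (simp only: mult.assoc mult.left_commute[of _ p])
qed

section \<open>Taylor remainders under a Lipschitz condition\<close>

text \<open>The mean value inequality along the segment takes the place of an integral remainder:
  the derivative of \<open>\<psi>\<close> dominates that of \<open>\<phi>\<close>. The codomain is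
  general so that \<open>G'\<close> may be operator-valued.\<close>

lemma taylor_bound_1:
  fixes G' :: "'a::real_normed_vector \<Rightarrow> 'b::real_normed_vector" and G'' :: "'a \<Rightarrow> 'a \<Rightarrow>\<^sub>L 'b"
  assumes "convex D" and G'': "\<And>z. z \<in> D \<Longrightarrow> (G' has_derivative G'' z) (at z)"
    and lipschitz: "\<And>y z. y \<in> D \<Longrightarrow> z \<in> D \<Longrightarrow> norm (G'' y - G'' z) \<le> L * norm (y - z)"
    and xy: "x \<in> D" "y \<in> D"
  shows "norm (G' y - G' x - G'' x (y - x)) \<le> L / 2 * (norm (y - x))\<^sup>2"
proof -
  define h where "h = y - x"
  define \<phi> where "\<phi> s = G' (x + s *\<^sub>R h) - s *\<^sub>R G'' x h" for s
  define \<psi> where "\<psi> s = L / 2 * (norm h)\<^sup>2 * s\<^sup>2" for s :: real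
  have seg: "x + s *\<^sub>R h \<in> D" if "0 \<le> s" "s \<le> 1" for s
    using convexD_alt[OF \<open>convex D\<close> xy that] by (simp add: h_def algebra_simps)
  have d\<phi>: "(\<phi> has_vector_derivative (G'' (x + s *\<^sub>R h) h - G'' x h)) (at s)" if "0 \<le> s" "s \<le> 1" for s
  proof -
    have "((\<lambda>s. x + s *\<^sub>R h) has_derivative (\<lambda>s. s *\<^sub>R h)) (at s)"
      by (auto intro!: derivative_eq_intros)
    from has_derivative_compose[OF this G''[OF seg[OF that]]] show ?thesis
      unfolding \<phi>_def has_vector_derivative_def
      by (auto intro!: derivative_eq_intros simp: blinfun.bilinear_simps algebra_simps)
  qed
  have d\<psi>: "(\<psi> has_vector_derivative (L * norm (s *\<^sub>R h) * norm h)) (at s)" if "0 \<le> s" for s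
    unfolding \<psi>_def using that
    by (auto intro!: derivative_eq_intros
        simp: has_real_derivative_iff_has_vector_derivative[symmetric] power2_eq_square)
  have "norm (\<phi> 1 - \<phi> 0) \<le> \<psi> 1 - \<psi> 0"
  proof (rule differentiable_bound_general[OF zero_less_one _ _ d\<phi> d\<psi>])
    show "continuous_on {0..1} \<phi>"
      using d\<phi> by (intro continuous_at_imp_continuous_on ballI)
        (auto intro: has_vector_derivative_continuous)
    show "continuous_on {0..1} \<psi>" unfolding \<psi>_def by (intro continuous_intros)
    fix s :: real assume s: "0 < s" "s < 1"
    have "norm (G'' (x + s *\<^sub>R h) - G'' x) \<le> L * norm (s *\<^sub>R h)"
      using lipschitz[of "x + s *\<^sub>R h" x] seg[of s] s xy by simp
    then show "norm (G'' (x + s *\<^sub>R h) h - G'' x h) \<le> L * norm (s *\<^sub>R h) * norm h"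
      unfolding blinfun.diff_left[symmetric] by (meson mult_right_mono norm_blinfun norm_ge_zero order_trans)
  qed simp_all
  then show ?thesis by (simp add: \<phi>_def \<psi>_def h_def algebra_simps)
qed

text \<open>Here the derivative of \<open>\<phi>\<close> is the first-order remainder of
  \<open>G'\<close> applied to \<open>h\<close>, so \<open>taylor_bound_1\<close> bounds it and the
  mean value inequality turns \<open>L / 2\<close> into \<open>L / 6\<close>.\<close>

lemma taylor_bound_2:
  fixes G :: "'a::real_normed_vector \<Rightarrow> 'b::real_normed_vector"
    and G' :: "'a \<Rightarrow> 'a \<Rightarrow>\<^sub>L 'b" and G'' :: "'a \<Rightarrow> 'a \<Rightarrow>\<^sub>L 'a \<Rightarrow>\<^sub>L 'b"
  assumes "convex D" and G': "\<And>z. z \<in> D \<Longrightarrow> (G has_derivative G' z) (at z)"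
    and G'': "\<And>z. z \<in> D \<Longrightarrow> (G' has_derivative G'' z) (at z)"
    and lipschitz: "\<And>y z. y \<in> D \<Longrightarrow> z \<in> D \<Longrightarrow> norm (G'' y - G'' z) \<le> L * norm (y - z)"
    and xy: "x \<in> D" "y \<in> D"
  shows "norm (G y - G x - G' x (y - x) - (1/2) *\<^sub>R G'' x (y - x) (y - x)) \<le> L / 6 * norm (y - x) ^ 3"
proof -
  define h where "h = y - x"
  define \<phi> where "\<phi> s = G (x + s *\<^sub>R h) - s *\<^sub>R G' x h - (s\<^sup>2 / 2) *\<^sub>R G'' x h h" for s
  define \<psi> where "\<psi> s = L / 6 * norm h ^ 3 * s ^ 3" for s :: real
  have seg: "x + s *\<^sub>R h \<in> D" if "0 \<le> s" "s \<le> 1" for s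
    using convexD_alt[OF \<open>convex D\<close> xy that] by (simp add: h_def algebra_simps)
  have d\<phi>: "(\<phi> has_vector_derivative (G' (x + s *\<^sub>R h) - G' x - G'' x (s *\<^sub>R h)) h) (at s)"
    if "0 \<le> s" "s \<le> 1" for s
  proof -
    have "((\<lambda>s. x + s *\<^sub>R h) has_derivative (\<lambda>s. s *\<^sub>R h)) (at s)"
      by (auto intro!: derivative_eq_intros)
    from has_derivative_compose[OF this G'[OF seg[OF that]]] show ?thesis
      unfolding \<phi>_def has_vector_derivative_def
      by (auto intro!: derivative_eq_intros simp: blinfun.bilinear_simps algebra_simps)
  qed
  have d\<psi>: "(\<psi> has_vector_derivative (L / 2 * (norm (s *\<^sub>R h))\<^sup>2 * norm h)) (at s)" if "0 \<le> s" for s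
    unfolding \<psi>_def using that
    by (auto intro!: derivative_eq_intros
        simp: has_real_derivative_iff_has_vector_derivative[symmetric] power2_eq_square power3_eq_cube)
  have "norm (\<phi> 1 - \<phi> 0) \<le> \<psi> 1 - \<psi> 0"
  proof (rule differentiable_bound_general[OF zero_less_one _ _ d\<phi> d\<psi>])
    show "continuous_on {0..1} \<phi>"
      using d\<phi> by (intro continuous_at_imp_continuous_on ballI)
        (auto intro: has_vector_derivative_continuous)
    show "continuous_on {0..1} \<psi>" unfolding \<psi>_def by (intro continuous_intros)
    fix s :: real assume s: "0 < s" "s < 1"
    have "norm (G' (x + s *\<^sub>R h) - G' x - G'' x (s *\<^sub>R h)) \<le> L / 2 * (norm (s *\<^sub>R h))\<^sup>2"
      using taylor_bound_1[OF \<open>convex D\<close> G'' lipschitz xy(1) seg[of s]] s by simp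
    then show "norm ((G' (x + s *\<^sub>R h) - G' x - G'' x (s *\<^sub>R h)) h) \<le> L / 2 * (norm (s *\<^sub>R h))\<^sup>2 * norm h"
      by (meson mult_right_mono norm_blinfun norm_ge_zero order_trans)
  qed simp_all
  then show ?thesis by (simp add: \<phi>_def \<psi>_def h_def algebra_simps)
qed

section \<open>The majorizing cubic and its Halley sequence\<close>

lemma deriv_majorant: "deriv (majorant \<beta> \<eta> L) = (\<lambda>t. - (1 - \<eta> * t - L / 2 * t\<^sup>2))"
  by (rule ext, rule DERIV_imp_deriv)
     (auto intro!: derivative_eq_intros simp: majorant_def[abs_def])

lemma deriv2_majorant: "deriv (deriv (majorant \<beta> \<eta> L)) = (\<lambda>t. \<eta> + L * t)"
  unfolding deriv_majorant
  by (rule ext, rule DERIV_imp_deriv) (auto intro!: derivative_eq_intros)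

text \<open>\<open>a\<close> stands for the smallest positive root of the majorant.
  \<open>slope\<close> says that the derivative at \<open>a\<close> is negative, which keeps
  \<open>p\<close> positive on all of \<open>[0, a]\<close>.\<close>

locale halley_cubic =
  fixes \<beta> \<eta> L a :: real
  assumes pos: "0 < \<beta>" "0 < \<eta>" "0 < L" "0 < a"
    and root: "majorant \<beta> \<eta> L a = 0"
    and first_root: "\<And>s. 0 < s \<Longrightarrow> s \<le> a \<Longrightarrow> majorant \<beta> \<eta> L s = 0 \<Longrightarrow> s = a"
    and slope: "0 < 1 - \<eta> * a - L / 2 * a\<^sup>2"
begin

abbreviation f where "f \<equiv> majorant \<beta> \<eta> L"
definition p where "p s = 1 - \<eta> * s - L / 2 * s\<^sup>2"
definition q where "q s = \<eta> + L * s"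
definition l where "l s = f s * q s / (2 * (p s)\<^sup>2)"
definition t where "t = halley_real_seq f"

lemma majorant_taylor: "f (s + d) = f s - p s * d + q s * d\<^sup>2 / 2 + L * d ^ 3 / 6"
  by (simp add: majorant_def p_def q_def field_simps power2_eq_square power3_eq_cube)

text \<open>Taylor's formula is exact for a cubic; expanding from \<open>s\<close> to the root gives
  the representation that \<open>halley_scalar_step\<close> requires, with
  \<open>\<tau> = a - s\<close>.\<close>

lemma majorant_at_root: "f s = p s * (a - s) - q s * (a - s)\<^sup>2 / 2 - L * (a - s) ^ 3 / 6"
  using majorant_taylor[of s "a - s"] root by simp

lemma p_antimono: "0 \<le> s \<Longrightarrow> s \<le> s' \<Longrightarrow> p s' \<le> p s"
  unfolding p_def using pos by (intro diff_mono mult_left_mono power_mono) auto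

lemma p_pos: "0 \<le> s \<Longrightarrow> s \<le> a \<Longrightarrow> 0 < p s"
  using p_antimono[of s a] slope by (simp add: p_def)

lemma p_le_1: "0 \<le> s \<Longrightarrow> p s \<le> 1"
  using p_antimono[of 0 s] by (simp add: p_def)

lemma q_pos: "0 \<le> s \<Longrightarrow> 0 < q s"
  using pos by (simp add: q_def add_pos_nonneg)

lemma t_0: "t 0 = 0"
  by (simp add: t_def)

lemma deriv_f: "deriv f s = - p s"
  by (simp add: deriv_majorant p_def)

lemma halley_real_L_majorant: "halley_real_L f s = l s"
  by (simp only: halley_real_L_def deriv2_majorant deriv_f l_def q_def power2_minus)

lemma t_Suc: "t (Suc k) = t k + f (t k) / p (t k) / (1 - l (t k))"
  unfolding t_def halley_real_seq.simps(2) Let_def halley_real_L_majorant deriv_f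
  by simp

text \<open>The invariants support one another: \<open>f (t k) > 0\<close> makes the step advance,
  while \<open>t k < a\<close> keeps \<open>p (t k)\<close> positive and the step short of
  \<open>a\<close>.\<close>

lemma t_bounds: "0 \<le> t k" "t k < a" "0 < f (t k)"
proof (induction k)
  case 0
  show "0 \<le> t 0" "t 0 < a" "0 < f (t 0)" using pos by (simp_all add: t_0 majorant_def)
next
  case (Suc k)
  define d where "d = f (t k) / p (t k) / (1 - l (t k))"
  note step = halley_scalar_step[OF Suc.IH(3) p_pos q_pos pos(3) _ majorant_at_root, folded l_def]
  have d_bounds: "0 < l (t k)" "0 < d" "d < a - t k"
    and eq: "f (t k) - p (t k) * d + q (t k) * d\<^sup>2 / 2 = q (t k) / 2 * (l (t k) * d\<^sup>2)"
    using step Suc.IH unfolding d_def by simp_all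
  show "0 \<le> t (Suc k)" "t (Suc k) < a" unfolding t_Suc d_def[symmetric] using d_bounds Suc.IH by simp_all
  \<comment> \<open>In the exact expansion, \<open>eq\<close> rewrites the part up to second order,
    which leaves two positive terms.\<close>
  have "f (t (Suc k)) = q (t k) / 2 * (l (t k) * d\<^sup>2) + L * d ^ 3 / 6"
    unfolding t_Suc d_def[symmetric] majorant_taylor eq ..
  moreover have "0 < q (t k) / 2 * (l (t k) * d\<^sup>2)" "0 < L * d ^ 3 / 6"
    using d_bounds q_pos Suc.IH pos by simp_all
  ultimately show "0 < f (t (Suc k))" by linarith
qed

text \<open>These are the exact values with which the operator estimates are compared: the fifth for
  the residual after a step, the last for the distance to the root.\<close>

lemma t_step:
  shows "0 < l (t k)" "4 * l (t k) \<le> 1" "t k < t (Suc k)"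
    and "f (t k) \<le> p (t k) * (t (Suc k) - t k)"
    and "f (t (Suc k)) = q (t k) / 2 * (l (t k) * (t (Suc k) - t k)\<^sup>2) + L / 6 * (t (Suc k) - t k) ^ 3"
    and "(1 - l (t k)) * p (t k) * (a - t (Suc k)) =
      q (t k) / (2 * p (t k)) * (q (t k) / 2 * (a - t k)\<^sup>2 + L / 6 * (a - t k) ^ 3) * (a - t k)
      + L / 6 * (a - t k) ^ 3"
proof -
  have d: "t (Suc k) - t k = f (t k) / p (t k) / (1 - l (t k))" by (simp add: t_Suc)
  have a: "a - t (Suc k) = a - t k - (t (Suc k) - t k)" by simp
  note step = halley_scalar_step[OF t_bounds(3) p_pos q_pos pos(3) _ majorant_at_root, 
      folded l_def, of k, folded d, folded a]
  show "0 < l (t k)" "4 * l (t k) \<le> 1" "f (t k) \<le> p (t k) * (t (Suc k) - t k)"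
    "(1 - l (t k)) * p (t k) * (a - t (Suc k)) =
      q (t k) / (2 * p (t k)) * (q (t k) / 2 * (a - t k)\<^sup>2 + L / 6 * (a - t k) ^ 3) * (a - t k)
      + L / 6 * (a - t k) ^ 3"
    using step t_bounds[of k] by simp_all
  show "t k < t (Suc k)" using step(3) t_bounds[of k] by simp
  show "f (t (Suc k)) = q (t k) / 2 * (l (t k) * (t (Suc k) - t k)\<^sup>2) + L / 6 * (t (Suc k) - t k) ^ 3"
    using step(6) majorant_taylor[of "t k" "t (Suc k) - t k"] t_bounds[of k] by simp
qed

lemma t_incseq: "incseq t"
  using t_step(3) by (simp add: incseq_SucI less_imp_le)

text \<open>The increasing bounded sequence has a limit. Since \<open>p \<le> 1\<close>,
  \<open>f (t k)\<close> is at most the step length and tends to 0, so the limit is a root in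
  \<open>(0, a]\<close>, where \<open>first_root\<close> leaves only \<open>a\<close>.\<close>

lemma t_tendsto: "t \<longlonglongrightarrow> a"
proof -
  obtain c where c: "t \<longlonglongrightarrow> c" "\<And>k. t k \<le> c"
    using incseq_convergent[OF t_incseq, of a] t_bounds(2) less_imp_le by metis
  have "(\<lambda>k. f (t k)) \<longlonglongrightarrow> f c"
    unfolding majorant_def by (intro tendsto_intros c)
  moreover have "(\<lambda>k. f (t k)) \<longlonglongrightarrow> 0"
  proof (rule tendsto_sandwich[where f = "\<lambda>_. 0" and h = "\<lambda>k. t (Suc k) - t k"])
    show "(\<lambda>k. t (Suc k) - t k) \<longlonglongrightarrow> 0"
      using tendsto_diff[OF LIMSEQ_Suc[OF c(1)] c(1)] by simp
    have "f (t k) \<le> t (Suc k) - t k" for k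
    proof -
      have "p (t k) * (t (Suc k) - t k) \<le> 1 * (t (Suc k) - t k)"
        using p_le_1[OF t_bounds(1)] t_step(3)[of k] by (intro mult_right_mono) auto
      then show ?thesis using t_step(4)[of k] by simp
    qed
    then show "\<forall>\<^sub>F k in sequentially. f (t k) \<le> t (Suc k) - t k" by simp
    show "\<forall>\<^sub>F k in sequentially. 0 \<le> f (t k)" using t_bounds(3) by (simp add: less_imp_le)
  qed simp
  ultimately have "f c = 0" by (rule LIMSEQ_unique)
  moreover have "0 < c" using t_bounds(1)[of 0] t_step(3)[of 0] c(2)[of "Suc 0"] by linarith
  moreover have "c \<le> a" using LIMSEQ_le_const2[OF c(1)] t_bounds(2) less_imp_le by blast
  ultimately show ?thesis using first_root c(1) by blast
qed

text \<open>The hypothesis on \<open>e\<close> is the last identity of \<open>t_step\<close> with \<open>a - t k\<close> lowered to \<open>E\<close>.\<close>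

lemma contraction_ratio:
  assumes "0 \<le> E" "E \<le> a - t k"
    and e: "(1 - l (t k)) * p (t k) * e \<le>
      q (t k) / (2 * p (t k)) * (q (t k) / 2 * E\<^sup>2 + L / 6 * E ^ 3) * E + L / 6 * E ^ 3"
  shows "e \<le> (a - t (Suc k)) * (E / (a - t k)) ^ 3"
proof -
  define \<tau> where "\<tau> = a - t k"
  define \<rho> where "\<rho> = E / \<tau>"
  have \<tau>: "0 < \<tau>" using t_bounds by (simp add: \<tau>_def)
  have E: "E = \<rho> * \<tau>" and \<rho>: "0 \<le> \<rho>" "\<rho> \<le> 1" using \<tau> assms by (simp_all add: \<rho>_def \<tau>_def)
  have p0: "0 < p (t k)" and q0: "0 < q (t k)" using p_pos q_pos t_bounds less_imp_le by blast+
  have lp: "0 < (1 - l (t k)) * p (t k)" using t_step(2)[of k] p0 by simp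
  have "(1 - l (t k)) * p (t k) * e \<le>
      q (t k) / (2 * p (t k)) * (q (t k) / 2 * \<tau>\<^sup>2 + L / 6 * \<rho> * \<tau> ^ 3) * \<tau> * \<rho> ^ 3 + L / 6 * \<tau> ^ 3 * \<rho> ^ 3"
    using e unfolding E by (simp add: algebra_simps power2_eq_square power3_eq_cube)
  \<comment> \<open>The one term of fourth order in \<open>\<rho>\<close> carries a spare factor
    \<open>\<rho> \<le> 1\<close>; replacing it by 1 leaves \<open>\<rho> ^ 3\<close> as a common
    factor.\<close>
  also have "\<dots> \<le> q (t k) / (2 * p (t k)) * (q (t k) / 2 * \<tau>\<^sup>2 + L / 6 * 1 * \<tau> ^ 3) * \<tau> * \<rho> ^ 3 + L / 6 * \<tau> ^ 3 * \<rho> ^ 3"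
    using p0 q0 \<rho> \<tau> pos
    by (intro add_mono mult_right_mono mult_left_mono order.refl) auto
  also have "\<dots> = (1 - l (t k)) * p (t k) * ((a - t (Suc k)) * \<rho> ^ 3)"
    unfolding mult.assoc[symmetric] t_step(6) by (simp add: \<tau>_def algebra_simps)
  finally show ?thesis
    unfolding \<rho>_def \<tau>_def using lp mult_le_cancel_left_pos by blast
qed

text \<open>In the exact error formula, \<open>l \<le> 1/4\<close> bounds \<open>1 - l\<close> below
  by \<open>3/4\<close>, and monotonicity moves the remaining values of \<open>p\<close> and
  \<open>q\<close> to \<open>a\<close>.\<close>

lemma cubic_constant:
  "a - t (Suc k) \<le> (3 * (q a)\<^sup>2 + 2 * L * p a) / (9 * (p a)\<^sup>2) * (a - t k) ^ 3"
proof -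
  define \<tau> where "\<tau> = a - t k"
  define P where "P = p (t k)"
  define Q where "Q = q (t k)"
  have \<tau>: "0 < \<tau>" using t_bounds by (simp add: \<tau>_def)
  have P: "0 < p a" "p a \<le> P"
    using p_pos[of a] p_antimono[of "t k" a] pos t_bounds[of k] by (simp_all add: P_def)
  have Q: "0 < Q" "q a = Q + L * \<tau>"
    using q_pos t_bounds[of k] by (simp_all add: Q_def \<tau>_def) (simp add: q_def algebra_simps)
  have "3 / 4 * P * (a - t (Suc k)) \<le> (1 - l (t k)) * P * (a - t (Suc k))"
    using t_step(2)[of k] P t_bounds(2)[of "Suc k"] by (intro mult_right_mono) auto
  also have "\<dots> = (Q * (Q + L * \<tau> / 3) / (4 * P) + L / 6) * \<tau> ^ 3"
    unfolding P_def t_step(6)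
    unfolding P_def[symmetric] Q_def[symmetric] \<tau>_def[symmetric]
    using P by (simp add: field_simps power2_eq_square power3_eq_cube)
  finally have "a - t (Suc k) \<le> (Q * (Q + L * \<tau> / 3) / (4 * P) + L / 6) * \<tau> ^ 3 / (3 / 4 * P)"
    using P by (simp add: pos_le_divide_eq mult.commute)
  also have "\<dots> = (Q * (Q + L * \<tau> / 3) / (3 * P\<^sup>2) + 2 * L / (9 * P)) * \<tau> ^ 3"
    using P by (simp add: field_simps power2_eq_square)
  also have "\<dots> \<le> ((q a)\<^sup>2 / (3 * (p a)\<^sup>2) + 2 * L / (9 * p a)) * \<tau> ^ 3"
  proof (intro mult_right_mono add_mono frac_le)
    \<comment> \<open>Both factors are at most \<open>q a = Q + L * \<tau>\<close>.\<close>
    show "Q * (Q + L * \<tau> / 3) \<le> (q a)\<^sup>2"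
      unfolding Q(2) power2_eq_square using Q(1) \<tau> pos by (intro mult_mono) auto
  qed (use P \<tau> pos in \<open>auto intro: power_mono\<close>)
  also have "(q a)\<^sup>2 / (3 * (p a)\<^sup>2) + 2 * L / (9 * p a) = (3 * (q a)\<^sup>2 + 2 * L * p a) / (9 * (p a)\<^sup>2)"
    using P by (simp add: field_simps power2_eq_square)
  finally show ?thesis by (simp add: \<tau>_def)
qed

text \<open>Once the factor \<open>u - a\<close> is split off, the cofactor is strictly increasing
  for \<open>u \<ge> 0\<close> and vanishes at \<open>r\<close>.\<close>

lemma majorant_neg_between_roots:
  assumes "a < r" "f r = 0" "a < s" "s < r"
  shows "f s < 0"
proof -
  have factor: "f u = (u - a) * (\<eta> / 2 * (u + a) + L / 6 * (u\<^sup>2 + u * a + a\<^sup>2) - 1)" for u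
    using root by (simp add: majorant_def field_simps power2_eq_square power3_eq_cube)
  have "\<eta> / 2 * (r + a) + L / 6 * (r\<^sup>2 + r * a + a\<^sup>2) - 1 = 0"
    using assms factor[of r] by simp
  moreover have "\<eta> / 2 * (s + a) < \<eta> / 2 * (r + a)" using assms pos by simp
  moreover have "s\<^sup>2 + s * a + a\<^sup>2 < r\<^sup>2 + r * a + a\<^sup>2"
    using assms pos by (intro add_strict_right_mono add_strict_mono power_strict_mono) auto
  then have "L / 6 * (s\<^sup>2 + s * a + a\<^sup>2) < L / 6 * (r\<^sup>2 + r * a + a\<^sup>2)" using pos by simp
  ultimately show ?thesis unfolding factor using assms by (intro mult_pos_neg) auto
qed

end

section \<open>Majorization of Halley's method for a normalized operator\<close>

text \<open>\<open>G\<close> stands for \<open>F\<close> composed with the inverse of its derivative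
  at \<open>x0\<close>. The closed ball is placed in \<open>D\<close> so that the limit of the
  iterates stays in the domain.\<close>

locale halley_majorized = halley_cubic \<beta> \<eta> L a for \<beta> \<eta> L a +
  fixes G :: "'a::banach \<Rightarrow> 'a" and G' :: "'a \<Rightarrow> 'a \<Rightarrow>\<^sub>L 'a" and G'' :: "'a \<Rightarrow> 'a \<Rightarrow>\<^sub>L 'a \<Rightarrow>\<^sub>L 'a"
    and D :: "'a set" and x0 :: 'a
  assumes convex: "convex D" and cball: "cball x0 a \<subseteq> D"
    and G': "\<And>z. z \<in> D \<Longrightarrow> (G has_derivative G' z) (at z)"
    and G'': "\<And>z. z \<in> D \<Longrightarrow> (G' has_derivative G'' z) (at z)"
    and lipschitz: "\<And>y z. y \<in> D \<Longrightarrow> z \<in> D \<Longrightarrow> norm (G'' y - G'' z) \<le> L * norm (y - z)"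
    and G_x0: "norm (G x0) \<le> \<beta>" and G'_x0: "G' x0 = id_blinfun" and G''_x0: "norm (G'' x0) \<le> \<eta>"
begin

definition x where "x = halley_seq G G' G'' x0"

lemma x0_in_D: "x0 \<in> D"
  using cball pos by auto

lemma taylor: "y \<in> D \<Longrightarrow> z \<in> D \<Longrightarrow>
    norm (G z - G y - G' y (z - y) - (1/2) *\<^sub>R G'' y (z - y) (z - y)) \<le> L / 6 * norm (z - y) ^ 3"
  by (rule taylor_bound_2[OF convex G' G'' lipschitz])

text \<open>Expand at \<open>x0\<close>, where \<open>G'\<close> is the identity:
  \<open>1 - p s\<close> is \<open>\<eta> * s + L / 2 * s ^ 2\<close>, the linear term plus the
  remainder bound.\<close>

lemma derivative_bounds:
  assumes z: "z \<in> D" "norm (z - x0) \<le> s"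
  shows "norm (id_blinfun - G' z) \<le> 1 - p s" "norm (G'' z) \<le> q s"
proof -
  have s: "0 \<le> s" using z(2) norm_ge_zero order_trans by blast
  have "norm (G' z - G' x0) \<le> norm (G'' x0 (z - x0)) + norm (G' z - G' x0 - G'' x0 (z - x0))"
    by (rule norm_triangle_sub)
  also have "\<dots> \<le> \<eta> * s + L / 2 * s\<^sup>2"
  proof (rule add_mono)
    show "norm (G'' x0 (z - x0)) \<le> \<eta> * s"
      using norm_blinfun[of "G'' x0" "z - x0"] mult_mono[OF G''_x0 z(2)] pos s by simp
    have "norm (G' z - G' x0 - G'' x0 (z - x0)) \<le> L / 2 * (norm (z - x0))\<^sup>2"
      by (rule taylor_bound_1[OF convex G'' lipschitz x0_in_D z(1)])
    also have "\<dots> \<le> L / 2 * s\<^sup>2" using z(2) pos by (intro mult_left_mono power_mono) auto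
    finally show "norm (G' z - G' x0 - G'' x0 (z - x0)) \<le> L / 2 * s\<^sup>2" .
  qed
  finally show "norm (id_blinfun - G' z) \<le> 1 - p s"
    by (simp add: G'_x0 p_def norm_minus_commute)
  have "norm (G'' z) \<le> norm (G'' x0) + norm (G'' z - G'' x0)" by (rule norm_triangle_sub)
  also have "\<dots> \<le> \<eta> + L * norm (z - x0)"
    using G''_x0 lipschitz[OF z(1) x0_in_D] by simp
  also have "\<dots> \<le> q s" using z(2) pos by (simp add: q_def)
  finally show "norm (G'' z) \<le> q s" .
qed

lemma in_D: "norm (z - x0) \<le> t k \<Longrightarrow> z \<in> D"
  using cball t_bounds(2)[of k] by (auto simp: dist_norm norm_minus_commute)

text \<open>The correction \<open>d\<close> of \<open>halley_operator_step\<close> at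
  \<open>x k\<close>, signed so that the iteration adds it.\<close>

definition step where
  "step k = - blinfun_inv (id_blinfun - halley_operator G G' G'' (x k)) (blinfun_inv (G' (x k)) (G (x k)))"

lemma x_0: "x 0 = x0" and x_Suc: "x (Suc k) = x k + step k"
  by (simp_all add: x_def step_def Let_def)

text \<open>\<open>x_k\<close> is the induction hypothesis of \<open>invariant\<close>;
  \<open>x_step\<close> discharges it afterwards.\<close>

context
  fixes k
  assumes x_k: "norm (x k - x0) \<le> t k" "norm (G (x k)) \<le> f (t k)"
begin

lemma operator_step:
  shows "blinfun_invertible (G' (x k))"
    and "blinfun_invertible (id_blinfun - halley_operator G G' G'' (x k))"
    and "norm (step k) \<le> t (Suc k) - t k"
    and "norm (G (x k) + G' (x k) (step k) + (1/2) *\<^sub>R G'' (x k) (step k) (step k))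
      \<le> q (t k) / 2 * (l (t k) * (norm (step k))\<^sup>2)"
    and "\<And>e. norm (- G (x k) - G' (x k) e - (1/2) *\<^sub>R G'' (x k) e e) \<le> L / 6 * norm e ^ 3 \<Longrightarrow>
      (1 - l (t k)) * p (t k) * norm (e - step k)
      \<le> q (t k) / (2 * p (t k)) * (q (t k) / 2 * (norm e)\<^sup>2 + L / 6 * norm e ^ 3) * norm e
        + L / 6 * norm e ^ 3"
proof -
  have l: "l (t k) < 1" using t_step(2)[of k] by simp
  have p: "0 < p (t k)" using p_pos t_bounds[of k] by simp
  \<comment> \<open>Each derivative bound consumes \<open>x_k(1)\<close> twice, once for membership
    in \<open>D\<close> and once for the distance to \<open>x0\<close>.\<close>
  note step = halley_operator_step[where G = G and G' = G' and G'' = G'' and x = "x k",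
      OF derivative_bounds(1)[OF in_D] p _ derivative_bounds(2)[OF in_D] l_def l,
      OF x_k(1) x_k(1) x_k(2) x_k(1) x_k(1), folded step_def]
  show "blinfun_invertible (G' (x k))"
    "blinfun_invertible (id_blinfun - halley_operator G G' G'' (x k))"
    by (fact step)+
  show "norm (step k) \<le> t (Suc k) - t k" using step(3) by (simp add: t_Suc)
  show "norm (G (x k) + G' (x k) (step k) + (1/2) *\<^sub>R G'' (x k) (step k) (step k))
      \<le> q (t k) / 2 * (l (t k) * (norm (step k))\<^sup>2)" by (fact step)
  show "(1 - l (t k)) * p (t k) * norm (e - step k)
      \<le> q (t k) / (2 * p (t k)) * (q (t k) / 2 * (norm e)\<^sup>2 + L / 6 * norm e ^ 3) * norm e
        + L / 6 * norm e ^ 3"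
    if "norm (- G (x k) - G' (x k) e - (1/2) *\<^sub>R G'' (x k) e e) \<le> L / 6 * norm e ^ 3" for e
    by (rule step(5)[OF that])
qed

text \<open>The new value of \<open>G\<close> splits into the residual of the quadratic model and
  the Taylor remainder. Both bounds grow with \<open>norm (step k)\<close>, and at the scalar step
  length they add up to exactly \<open>f (t (Suc k))\<close>.\<close>

lemma invariant_step:
  "norm (x (Suc k) - x0) \<le> t (Suc k)" "norm (G (x (Suc k))) \<le> f (t (Suc k))"
proof -
  let ?d = "step k" and ?\<delta> = "t (Suc k) - t k"
  show x': "norm (x (Suc k) - x0) \<le> t (Suc k)"
    using norm_triangle_ineq[of "x k - x0" ?d] x_k(1) operator_step(3)
    by (simp add: x_Suc algebra_simps)
  have "norm (G (x (Suc k))) \<le> norm (G (x k) + G' (x k) ?d + (1/2) *\<^sub>R G'' (x k) ?d ?d)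
      + norm (G (x (Suc k)) - G (x k) - G' (x k) ?d - (1/2) *\<^sub>R G'' (x k) ?d ?d)"
    by (rule order_trans[OF eq_refl norm_triangle_ineq]) (simp add: algebra_simps)
  also have "\<dots> \<le> q (t k) / 2 * (l (t k) * (norm ?d)\<^sup>2) + L / 6 * norm ?d ^ 3"
    using operator_step(4) taylor[OF in_D[OF x_k(1)] in_D[OF x']] by (simp add: x_Suc)
  also have "\<dots> \<le> q (t k) / 2 * (l (t k) * ?\<delta>\<^sup>2) + L / 6 * ?\<delta> ^ 3"
    using operator_step(3) t_step(1)[of k] q_pos[OF t_bounds(1), of k] pos
    by (intro add_mono mult_left_mono power_mono) simp_all
  also have "\<dots> = f (t (Suc k))" by (rule t_step(5)[symmetric])
  finally show "norm (G (x (Suc k))) \<le> f (t (Suc k))" .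
qed

end

lemma invariant: "norm (x k - x0) \<le> t k \<and> norm (G (x k)) \<le> f (t k)"
proof (induction k)
  case 0
  show ?case using G_x0 by (simp add: x_0 t_0 majorant_def)
qed (use invariant_step in blast)

lemmas x_step = operator_step[OF conjunct1[OF invariant] conjunct2[OF invariant]]

lemma x_in: "x k \<in> D" "x k \<in> ball x0 a"
  using invariant[of k] t_bounds(2)[of k] in_D by (auto simp: dist_norm norm_minus_commute)

text \<open>Telescoping of the step bounds.\<close>

lemma x_diff: "n \<le> m \<Longrightarrow> norm (x m - x n) \<le> t m - t n"
proof (induction m rule: dec_induct)
  case (step m)
  then show ?case
    using norm_triangle_ineq[of "x m - x n" "local.step m"] x_step(3)[of m]
    by (simp add: x_Suc algebra_simps)
qed simp

text \<open>The distances between iterates are dominated by those of the convergent sequence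
  \<open>t\<close>. The limit is a zero because \<open>norm (G (x k)) \<le> f (t k)\<close> and
  \<open>f (t k)\<close> tends to \<open>f a = 0\<close>.\<close>

lemma x_convergent:
  obtains z where "x \<longlonglongrightarrow> z" "\<And>k. norm (z - x k) \<le> a - t k" "G z = 0"
proof -
  have "Cauchy x"
  proof (rule metric_CauchyI)
    fix e :: real assume "0 < e"
    from metric_CauchyD[OF LIMSEQ_imp_Cauchy[OF t_tendsto] this]
    obtain M where M: "\<forall>m\<ge>M. \<forall>n\<ge>M. dist (t m) (t n) < e" ..
    have "dist (x m) (x n) \<le> dist (t m) (t n)" for m n
    proof (cases m n rule: le_cases)
      case le
      then show ?thesis
        using x_diff[OF le] by (simp add: dist_real_def dist_norm norm_minus_commute[of "x m"])
    next
      case ge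
      then show ?thesis
        using x_diff[OF ge] by (simp add: dist_real_def dist_norm)
    qed
    then show "\<exists>M. \<forall>m\<ge>M. \<forall>n\<ge>M. dist (x m) (x n) < e"
      using M by (blast intro: order_le_less_trans)
  qed
  then obtain z where z: "x \<longlonglongrightarrow> z" by (auto simp: Cauchy_convergent_iff convergent_def)
  have dist: "norm (z - x k) \<le> a - t k" for k
  proof (rule LIMSEQ_le)
    show "(\<lambda>m. norm (x m - x k)) \<longlonglongrightarrow> norm (z - x k)" by (intro tendsto_intros z)
    show "(\<lambda>m. t m - t k) \<longlonglongrightarrow> a - t k" by (intro tendsto_intros t_tendsto)
  qed (auto intro!: exI[of _ k] x_diff)
  \<comment> \<open>As \<open>t 0 = 0\<close>, the case \<open>k = 0\<close> places \<open>z\<close>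
    in the closed ball of radius \<open>a\<close>.\<close>
  have "z \<in> D" using dist[of 0] cball by (auto simp: x_0 t_0 dist_norm norm_minus_commute)
  then have "isCont G z" using has_derivative_continuous[OF G'] by simp
  then have "(\<lambda>k. G (x k)) \<longlonglongrightarrow> G z" using z by (rule isCont_tendsto_compose)
  moreover have "(\<lambda>k. f (t k)) \<longlonglongrightarrow> f a"
    unfolding majorant_def by (intro tendsto_intros t_tendsto)
  then have "(\<lambda>k. G (x k)) \<longlonglongrightarrow> 0"
    using invariant unfolding root by - (rule Lim_null_comparison[OF always_eventually], simp_all)
  ultimately have "G z = 0" by (rule LIMSEQ_unique)
  with z dist show thesis by (rule that)
qed

text \<open>With \<open>e = z - x k\<close> the remainder hypothesis of \<open>x_step(5)\<close> is
  Taylor's formula at \<open>x k\<close> with \<open>G z = 0\<close>, and \<open>e - step k\<close>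
  is the next error. Any zero \<open>z\<close> is allowed, not just the limit, because uniqueness
  rests on this estimate.\<close>

lemma error_bound:
  assumes "z \<in> D" "G z = 0" "norm (z - x k) \<le> a - t k"
  shows "norm (z - x (Suc k)) \<le> (a - t (Suc k)) * (norm (z - x k) / (a - t k)) ^ 3"
proof (rule contraction_ratio[OF norm_ge_zero assms(3)])
  have eq: "z - x (Suc k) = (z - x k) - step k" by (simp add: x_Suc)
  show "(1 - l (t k)) * p (t k) * norm (z - x (Suc k))
      \<le> q (t k) / (2 * p (t k)) * (q (t k) / 2 * (norm (z - x k))\<^sup>2 + L / 6 * norm (z - x k) ^ 3) *
        norm (z - x k) + L / 6 * norm (z - x k) ^ 3"
    unfolding eq using x_step(5)[of k "z - x k"] taylor[OF x_in(1)[of k] assms(1)] assms(2) by simp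
qed

text \<open>Inserting \<open>cubic_constant\<close> into \<open>error_bound\<close> cancels
  \<open>(a - t k) ^ 3\<close>.\<close>

lemma cubic_bound:
  assumes "z \<in> D" "G z = 0" "norm (z - x k) \<le> a - t k"
  shows "norm (z - x (Suc k)) \<le> (3 * (q a)\<^sup>2 + 2 * L * p a) / (9 * (p a)\<^sup>2) * norm (z - x k) ^ 3"
proof -
  have \<tau>: "0 < a - t k" using t_bounds(2)[of k] by simp
  have "norm (z - x (Suc k)) \<le> (a - t (Suc k)) * (norm (z - x k) / (a - t k)) ^ 3"
    by (rule error_bound[OF assms])
  also have "\<dots> \<le> ((3 * (q a)\<^sup>2 + 2 * L * p a) / (9 * (p a)\<^sup>2) * (a - t k) ^ 3)
      * (norm (z - x k) / (a - t k)) ^ 3"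
    using \<tau> by (intro mult_right_mono cubic_constant) simp
  also have "\<dots> = (3 * (q a)\<^sup>2 + 2 * L * p a) / (9 * (p a)\<^sup>2) * norm (z - x k) ^ 3"
    using \<tau> by (simp add: power_divide)
  finally show ?thesis .
qed

text \<open>The bound \<open>norm (z - x k) \<le> a - t k\<close> starts from \<open>t 0 = 0\<close>
  and persists because the cubed ratio is at most 1; its right-hand side tends to 0.\<close>

lemma zero_is_limit:
  assumes "z \<in> D" "G z = 0" "norm (z - x0) \<le> a"
  shows "x \<longlonglongrightarrow> z"
proof -
  have "norm (z - x k) \<le> a - t k" for k
  proof (induction k)
    case 0
    show ?case using assms(3) by (simp add: x_0 t_0)
  next
    case (Suc k)
    have "(norm (z - x k) / (a - t k)) ^ 3 \<le> 1"
      using Suc t_bounds(2)[of k] by (intro power_le_one) auto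
    then have "(a - t (Suc k)) * (norm (z - x k) / (a - t k)) ^ 3 \<le> (a - t (Suc k)) * 1"
      using t_bounds(2)[of "Suc k"] by (intro mult_left_mono) auto
    with error_bound[OF assms(1,2) Suc] show ?case by simp
  qed
  moreover have "(\<lambda>k. a - t k) \<longlonglongrightarrow> 0"
    using tendsto_diff[OF tendsto_const[of a] t_tendsto] by simp
  ultimately have "(\<lambda>k. x k - z) \<longlonglongrightarrow> 0"
    by - (rule Lim_null_comparison[OF always_eventually], simp_all add: norm_minus_commute)
  then show ?thesis by (simp add: LIM_zero_iff)
qed

text \<open>Solving Taylor's formula at \<open>x0\<close> for the linear term gives \<open>norm h
  \<le> \<beta> + \<eta> / 2 * norm h ^ 2 + L / 6 * norm h ^ 3\<close> with
  \<open>h = z - x0\<close>.\<close>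

lemma zero_majorant_nonneg:
  assumes "z \<in> D" "G z = 0"
  shows "0 \<le> f (norm (z - x0))"
proof -
  let ?h = "z - x0"
  have "norm ?h \<le> norm (G x0) + norm ((1/2) *\<^sub>R G'' x0 ?h ?h)
      + norm (G z - G x0 - G' x0 ?h - (1/2) *\<^sub>R G'' x0 ?h ?h)"
    (is "_ \<le> norm ?u + norm ?v + norm ?w")
  proof -
    have "?h = - (?u + ?v + ?w)" by (simp add: assms(2) G'_x0 algebra_simps)
    then have "norm ?h = norm (?u + ?v + ?w)" by (metis norm_minus_cancel)
    then show ?thesis using norm_triangle_ineq[of "?u + ?v" ?w] norm_triangle_ineq[of ?u ?v] by linarith
  qed
  moreover have "norm (G'' x0 ?h ?h) \<le> \<eta> * norm ?h * norm ?h"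
    using norm_blinfun[of "G'' x0 ?h" ?h] norm_blinfun[of "G'' x0" ?h] G''_x0
    by (meson mult_right_mono norm_ge_zero order_trans)
  ultimately show ?thesis
    using taylor[OF x0_in_D assms(1)] G_x0 by (simp add: majorant_def power2_eq_square)
qed

text \<open>Phrased as convergence, so that uniqueness of limits gives uniqueness of the zero. A
  distance strictly between \<open>a\<close> and \<open>r\<close> would make the majorant negative,
  so \<open>z\<close> lies in the closed ball.\<close>

lemma zero_unique:
  assumes "z \<in> D" "G z = 0" "norm (z - x0) < r" "a < r" "f r = 0"
  shows "x \<longlonglongrightarrow> z"
  using zero_is_limit[OF assms(1,2)] zero_majorant_nonneg[OF assms(1,2)]
    majorant_neg_between_roots[OF assms(4,5), of "norm (z - x0)"] assms(3) by force

end

section \<open>Transfer between an operator and its normalization\<close>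

text \<open>The inverse of \<open>F' z\<close> is \<open>S o\<^sub>L B\<close> with \<open>S\<close>
  the inverse of \<open>B o\<^sub>L F' z\<close>, so applying it to \<open>F z\<close> or to values
  of \<open>F'' z\<close> gives what \<open>S\<close> gives on the normalized data.\<close>

lemma halley_left_compose:
  fixes F :: "'a::banach \<Rightarrow> 'b::banach" and B :: "'b \<Rightarrow>\<^sub>L 'a"
  assumes BA: "B o\<^sub>L A = id_blinfun" "A o\<^sub>L B = id_blinfun"
    and inv: "blinfun_invertible (B o\<^sub>L F' z)"
  shows "blinfun_invertible (F' z)"
    and "blinfun_inv (F' z) = blinfun_inv (B o\<^sub>L F' z) o\<^sub>L B"
    and "halley_operator F F' F'' z =
      halley_operator (\<lambda>z. B (F z)) (\<lambda>z. B o\<^sub>L F' z) (\<lambda>z. blinfun_compose2 B (F'' z)) z"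
proof -
  let ?S = "blinfun_inv (B o\<^sub>L F' z)"
  have AB: "A (B w) = w" for w
    using arg_cong[OF BA(2), of "\<lambda>C. blinfun_apply C w"] by simp
  have "?S (B (F' z v)) = v" for v
    using blinfun_inv_apply(1)[OF inv, of v] by simp
  then have 1: "(?S o\<^sub>L B) o\<^sub>L F' z = id_blinfun" by (intro blinfun_eqI) simp
  have "B (F' z (?S w)) = w" for w
    using blinfun_inv_apply(2)[OF inv, of w] by simp
  \<comment> \<open>Instantiate at \<open>B w\<close> and cancel \<open>B\<close>, which has the
    left inverse \<open>A\<close>.\<close>
  then have "F' z (?S (B w)) = w" for w by (metis AB)
  then have 2: "F' z o\<^sub>L (?S o\<^sub>L B) = id_blinfun" by (intro blinfun_eqI) simp
  show "blinfun_invertible (F' z)" and eq: "blinfun_inv (F' z) = ?S o\<^sub>L B"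
    by (rule blinfun_inv_eqI[OF 1 2])+
  show "halley_operator F F' F'' z =
      halley_operator (\<lambda>z. B (F z)) (\<lambda>z. B o\<^sub>L F' z) (\<lambda>z. blinfun_compose2 B (F'' z)) z"
    unfolding halley_operator_def eq by (rule blinfun_eqI) (simp add: blinfun.bilinear_simps)
qed

text \<open>Invertibility is asked for along the normalized sequence, where the majorant argument
  provides it.\<close>

lemma halley_seq_left_compose:
  fixes F :: "'a::banach \<Rightarrow> 'b::banach" and F' :: "'a \<Rightarrow> 'a \<Rightarrow>\<^sub>L 'b"
    and F'' :: "'a \<Rightarrow> 'a \<Rightarrow>\<^sub>L 'a \<Rightarrow>\<^sub>L 'b" and x0 :: 'a and B :: "'b \<Rightarrow>\<^sub>L 'a"
  assumes BA: "B o\<^sub>L A = id_blinfun" "A o\<^sub>L B = id_blinfun"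
  defines "x \<equiv> halley_seq (\<lambda>z. B (F z)) (\<lambda>z. B o\<^sub>L F' z) (\<lambda>z. blinfun_compose2 B (F'' z)) x0"
  assumes inv: "\<And>k. blinfun_invertible (B o\<^sub>L F' (x k))"
  shows "halley_seq F F' F'' x0 k = x k"
proof (induction k)
  case 0
  show ?case by (simp add: x_def)
next
  case (Suc k)
  show ?case
    unfolding halley_seq.simps(2) Suc Let_def halley_left_compose(2,3)[where F' = F', OF BA inv]
    by (simp add: x_def Let_def)
qed

theorem theorem5:
  fixes F :: "'a::banach \<Rightarrow> 'b::banach"
    and F' :: "'a \<Rightarrow> 'a \<Rightarrow>\<^sub>L 'b"
    and F'' :: "'a \<Rightarrow> 'a \<Rightarrow>\<^sub>L 'a \<Rightarrow>\<^sub>L 'b"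
    and D :: "'a set"
    and x0 :: 'a
    and \<beta> \<eta> L r1 tstar tsstar :: real
    and f :: "real \<Rightarrow> real"
    and x :: "nat \<Rightarrow> 'a"
    and t :: "nat \<Rightarrow> real"
  assumes D: "D \<noteq> {}" "open D" "convex D"
    and F': "\<And>z. z \<in> D \<Longrightarrow> (F has_derivative blinfun_apply (F' z)) (at z)"
    and F'': "\<And>z. z \<in> D \<Longrightarrow> (F' has_derivative blinfun_apply (F'' z)) (at z)"
    and F''_cont: "continuous_on D F''"
    and x0: "x0 \<in> D" "blinfun_invertible (F' x0)"
    and pos: "\<beta> > 0" "\<eta> > 0" "L > 0"
    and lipschitz: "\<And>y z. y \<in> D \<Longrightarrow> z \<in> D \<Longrightarrow>
           norm (blinfun_compose2 (blinfun_inv (F' x0)) (F'' y - F'' z)) \<le> L * norm (y - z)"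
    and beta: "norm (blinfun_inv (F' x0) (F x0)) \<le> \<beta>"
    and eta: "norm (blinfun_compose2 (blinfun_inv (F' x0)) (F'' x0)) \<le> \<eta>"
    and crit: "\<beta> < 2 * (\<eta> + 2 * sqrt (\<eta>\<^sup>2 + 2 * L)) / (3 * (\<eta> + sqrt (\<eta>\<^sup>2 + 2 * L))\<^sup>2)"
    and f_eq: "f = majorant \<beta> \<eta> L"
    and r1_eq: "r1 = 2 / (\<eta> + sqrt (\<eta>\<^sup>2 + 2 * L))"
    and tstar: "0 < tstar" "tstar \<le> r1" "f tstar = 0"
           "\<And>s. 0 < s \<Longrightarrow> s \<le> r1 \<Longrightarrow> f s = 0 \<Longrightarrow> tstar \<le> s"
    and tsstar: "r1 \<le> tsstar" "f tsstar = 0"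
    and ball: "ball x0 tsstar \<subseteq> D"
    and x_eq: "x = halley_seq F F' F'' x0"
    and t_eq: "t = halley_real_seq f"
  shows "(\<forall>k. x k \<in> D \<and> blinfun_invertible (F' (x k)) \<and>
              blinfun_invertible (id_blinfun - halley_operator F F' F'' (x k))) \<and>
         (\<forall>k. x k \<in> ball x0 tstar) \<and>
         (\<forall>k. deriv f (t k) \<noteq> 0 \<and> halley_real_L f (t k) \<noteq> 1 \<and> t k \<noteq> tstar) \<and>
         (\<exists>xstar \<in> closure (ball x0 tstar).
            x \<longlonglongrightarrow> xstar \<and> F xstar = 0 \<and>
            xstar \<in> ball x0 tsstar \<and> (\<forall>y \<in> ball x0 tsstar. F y = 0 \<longrightarrow> y = xstar) \<and>
            (\<forall>k. norm (xstar - x (Suc k)) \<le>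
                  (tstar - t (Suc k)) * (norm (xstar - x k) / (tstar - t k)) ^ 3) \<and>
            Q_cubic x xstar \<and>
            (\<forall>k. norm (xstar - x (Suc k)) \<le>
                  (3 * (\<eta> + L * tstar)\<^sup>2 + 2 * L * (1 - \<eta> * tstar - L * tstar\<^sup>2 / 2)) /
                  (9 * (1 - \<eta> * tstar - L * tstar\<^sup>2 / 2)\<^sup>2) * norm (xstar - x k) ^ 3))"
proof -
  define B where "B = blinfun_inv (F' x0)"
  define G where "G z = B (F z)" for z
  define G' where "G' z = B o\<^sub>L F' z" for z
  define G'' where "G'' z = blinfun_compose2 B (F'' z)" for z
  have BA: "B o\<^sub>L F' x0 = id_blinfun" "F' x0 o\<^sub>L B = id_blinfun"
    unfolding B_def by (rule blinfun_inv[OF x0(2)])+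
  define s where "s = sqrt (\<eta>\<^sup>2 + 2 * L)"
  have "0 \<le> \<eta>\<^sup>2 + 2 * L" using pos by (intro add_nonneg_nonneg) simp_all
  then have s2: "s\<^sup>2 = \<eta>\<^sup>2 + 2 * L" by (simp add: s_def)
  have s0: "0 \<le> s" unfolding s_def by (rule real_sqrt_ge_zero) fact
  define u where "u = \<eta> + s"
  have u: "0 < u" using pos s0 by (simp add: u_def)
  have r1: "r1 = 2 / u" by (simp add: r1_eq u_def s_def)
  \<comment> \<open>From \<open>s ^ 2 - \<eta> ^ 2 = 2 * L\<close>. With \<open>L\<close> and
    \<open>r1\<close> expressed by \<open>s\<close>, \<open>\<eta>\<close> and \<open>u\<close>, the
    square root disappears from the computations.\<close>
  have L: "L = (s - \<eta>) * u / 2" using s2 by (simp add: u_def power2_eq_square algebra_simps)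
  \<comment> \<open>This is the vanishing of the derivative of \<open>f\<close> at
    \<open>r1\<close>.\<close>
  have slope_r1: "\<eta> * r1 + L / 2 * r1\<^sup>2 = 1"
  proof -
    have "\<eta> * r1 + L / 2 * r1\<^sup>2 = (2 * \<eta> + (s - \<eta>)) / u"
      unfolding r1 L using u by (simp add: field_simps power2_eq_square)
    also have "2 * \<eta> + (s - \<eta>) = u" by (simp add: u_def)
    finally show ?thesis using u by simp
  qed
  \<comment> \<open>\<open>crit\<close> is precisely this inequality: \<open>slope_r1\<close>
    eliminates the cubic term of \<open>f r1\<close>, and \<open>r1 = 2 / u\<close> does the
    rest.\<close>
  have "f r1 < 0"
  proof -
    have "f r1 = \<beta> - r1 * (2 / 3) + \<eta> / 6 * r1\<^sup>2"
    proof -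
      have "L / 6 * r1 ^ 3 = r1 / 3 * (L / 2 * r1\<^sup>2)" by (simp add: power2_eq_square power3_eq_cube)
      also have "L / 2 * r1\<^sup>2 = 1 - \<eta> * r1" using slope_r1 by linarith
      finally show ?thesis by (simp add: f_eq majorant_def field_simps power2_eq_square)
    qed
    also have "\<dots> = \<beta> - 2 * (2 * u - \<eta>) / (3 * u\<^sup>2)"
      unfolding r1 using u by (simp add: field_simps power2_eq_square)
    also have "2 * u - \<eta> = \<eta> + 2 * s" by (simp add: u_def)
    finally show ?thesis using crit by (simp add: u_def s_def)
  qed
  \<comment> \<open>\<open>r1\<close> is not a root, so the weak inequalities become strict. The
    first gives the negative derivative at \<open>tstar\<close>, the second fits the closed ball of
    radius \<open>tstar\<close> into the open one of radius \<open>tsstar\<close>.\<close>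
  then have tstar_r1: "tstar < r1" and tstar_tsstar: "tstar < tsstar"
    using tstar(2,3) tsstar by (auto simp: order.strict_iff_order)
  have "\<eta> * tstar + L / 2 * tstar\<^sup>2 < \<eta> * r1 + L / 2 * r1\<^sup>2"
    using tstar_r1 tstar(1) pos by (intro add_strict_mono mult_strict_left_mono power_strict_mono) auto
  then have slope: "0 < 1 - \<eta> * tstar - L / 2 * tstar\<^sup>2" using slope_r1 by linarith
  have cball_tsstar: "cball x0 tstar \<subseteq> ball x0 tsstar" using tstar_tsstar by auto
  interpret halley_majorized \<beta> \<eta> L tstar G G' G'' D x0
  proof
    show "(G has_derivative G' z) (at z)" if "z \<in> D" for z
      unfolding G_def G'_def
      using bounded_linear.has_derivative[OF blinfun.bounded_linear_right F'[OF that]]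
      by (simp add: blinfun_compose.rep_eq o_def)
    show "(G' has_derivative G'' z) (at z)" if "z \<in> D" for z
    proof -
      have "blinfun_apply (G'' z) = (\<lambda>v. B o\<^sub>L F'' z v)" by (rule ext) (simp add: G''_def)
      then show ?thesis
        using bounded_linear.has_derivative[OF bounded_bilinear.bounded_linear_right
          [OF bounded_bilinear_blinfun_compose] F''[OF that], of B] by (simp add: G'_def[abs_def])
    qed
    show "norm (G'' y - G'' z) \<le> L * norm (y - z)" if "y \<in> D" "z \<in> D" for y z
    proof -
      have "G'' y - G'' z = blinfun_compose2 B (F'' y - F'' z)"
        unfolding G''_def by (intro blinfun_eqI) (simp add: blinfun.bilinear_simps)
      then show ?thesis using lipschitz[OF that] by (simp add: B_def)
    qed
    show "\<And>s. 0 < s \<Longrightarrow> s \<le> tstar \<Longrightarrow> majorant \<beta> \<eta> L s = 0 \<Longrightarrow> s = tstar"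
      using tstar(2,4) by (fastforce simp: f_eq)
  qed (use D pos tstar slope beta eta cball_tsstar ball in \<open>auto simp: f_eq B_def G_def G'_def G''_def BA[unfolded B_def]\<close>)
  \<comment> \<open>\<open>x_step(1)\<close> supplies the invertibility needed to identify the two
    Halley sequences.\<close>
  have x: "x = local.x"
    unfolding x_eq local.x_def
    unfolding G_def[abs_def] G'_def[abs_def] G''_def[abs_def]
    by (rule ext, rule halley_seq_left_compose[OF BA],
        rule x_step(1)[unfolded local.x_def, unfolded G_def[abs_def] G'_def[abs_def] G''_def[abs_def]])
  have inv: "blinfun_invertible (B o\<^sub>L F' (x k))" for k
    using x_step(1)[of k] by (simp add: x G'_def)
  have halley: "halley_operator F F' F'' (x k) = halley_operator G G' G'' (x k)" for k
    unfolding G_def[abs_def] G'_def[abs_def] G''_def[abs_def] by (rule halley_left_compose(3)[where F' = F', OF BA inv])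
  have t: "t = local.t" by (simp add: t_eq local.t_def f_eq)
  \<comment> \<open>\<open>F' x0\<close> undoes \<open>B\<close>, so normalization preserves the
    zeros.\<close>
  have F0: "G z = 0 \<longleftrightarrow> F z = 0" for z
    using arg_cong[OF BA(2), of "\<lambda>C. blinfun_apply C (F z)"] by (auto simp: G_def)
  obtain z where z: "local.x \<longlonglongrightarrow> z" "\<And>k. norm (z - local.x k) \<le> tstar - local.t k" "G z = 0"
    using x_convergent by blast
  have "norm (z - x0) \<le> tstar" using z(2)[of 0] by (simp add: x_0 t_0)
  then have z_cball: "z \<in> cball x0 tstar" by (simp add: dist_norm norm_minus_commute)
  then have zD: "z \<in> D" using cball_tsstar ball by auto
  define C where "C = (3 * (\<eta> + L * tstar)\<^sup>2 + 2 * L * (1 - \<eta> * tstar - L * tstar\<^sup>2 / 2)) /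
                  (9 * (1 - \<eta> * tstar - L * tstar\<^sup>2 / 2)\<^sup>2)"
  have C: "norm (z - x (Suc k)) \<le> C * norm (z - x k) ^ 3" for k
    using cubic_bound[OF zD z(3) z(2), of k] by (simp add: C_def x p_def q_def)
  have "0 \<le> C" unfolding C_def using slope pos by (intro divide_nonneg_nonneg add_nonneg_nonneg) auto
  with C z(1) have "Q_cubic x z" unfolding Q_cubic_def x by blast
  moreover have "y = z" if "y \<in> ball x0 tsstar" "F y = 0" for y
  proof -
    have "local.x \<longlonglongrightarrow> y"
      using that ball tsstar(2)
      by (intro zero_unique[OF _ _ _ tstar_tsstar]) (auto simp: F0 f_eq dist_norm norm_minus_commute)
    then show ?thesis using z(1) by (rule LIMSEQ_unique)
  qed
  \<comment> \<open>These facts exclude division by zero, which would silently yield 0, from the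
    scalar iteration and from the error ratio; \<open>l \<le> 1/4\<close> settles the middle
    one.\<close>
  moreover have "deriv f (t k) \<noteq> 0 \<and> halley_real_L f (t k) \<noteq> 1 \<and> t k \<noteq> tstar" for k
    using t_step(2)[of k] t_bounds(1,2)[of k] p_pos[of "local.t k"]
    by (auto simp: t f_eq deriv_f halley_real_L_majorant)
  moreover have "norm (z - x (Suc k)) \<le> (tstar - t (Suc k)) * (norm (z - x k) / (tstar - t k)) ^ 3" for k
    unfolding x t by (rule error_bound[OF zD z(3) z(2)])
  moreover have "z \<in> closure (ball x0 tstar)" using z_cball tstar(1) by simp
  moreover have "z \<in> ball x0 tsstar" using z_cball cball_tsstar by auto
  moreover have "x \<longlonglongrightarrow> z" "F z = 0" using z(1,3) by (simp_all add: x F0)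
  moreover have "x k \<in> D \<and> blinfun_invertible (F' (x k)) \<and>
      blinfun_invertible (id_blinfun - halley_operator F F' F'' (x k))" for k
    using x_in(1)[of k] x_step(2)[of k] halley_left_compose(1)[where F' = F', OF BA inv] halley[of k] by (simp add: x)
  moreover have "x k \<in> ball x0 tstar" for k using x_in(2) by (simp add: x)
  ultimately show ?thesis using C unfolding C_def by blast
qed

end
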